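(* For any weakly mixing non-autonomous system $(X,\mathbb{F})$, $Q(X,\mathbb{F})=X\times X$.
   Context: A non-autonomous system $(X,\mathbb{F})$ consists of a compact metric space $(X,d_X)$ and a sequence $\mathbb{F}=(f_n)_{n\ge 1}$ of surjective continuous self-maps of $X$. For $k\in\mathbb{N}$, $\omega_k=f_k\circ\cdots\circ f_1$. $(X,\mathbb{F})$ is weakly mixing if for any non-empty open sets $U_1,U_2,V_1,V_2\subseteq X$ there is $k\in\mathbb{N}$ such that $\omega_k(U_i)\cap V_i\ne\emptyset$ for $i=1,2$. A pair $(x,y)\in X\times X$ is regionally proximal if for every $\epsilon>0$ and all neighborhoods $U$ of $x$ and $V$ of $y$ there are $z_1\in U$, $z_2\in V$ such that $\{n\in\mathbb{N}: d_X(\omega_n(z_1),\omega_n(z_2))<\epsilon\}$ is non-empty. $Q(X,\mathbb{F})$ is the set of regionally proximal pairs. *)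

theory Defs
  imports "HOL-Analysis.Abstract_Metric_Spaces"
begin

text \<open>The maps are indexed from 1, so the value \<open>f 0\<close> is irrelevant. The natural numbers
  are \<open>{1, 2, \<dots>}\<close> throughout: \<open>omega 0 = id\<close> only starts the recursion,
  and the definitions below quantify over positive times.\<close>

locale nonautonomous_system = Metric_space X d
  for X :: "'a set" and d :: "'a \<Rightarrow> 'a \<Rightarrow> real" +
  fixes f :: "nat \<Rightarrow> 'a \<Rightarrow> 'a"
  assumes compact: "compact_space mtopology"
    and continuous: "n \<ge> 1 \<Longrightarrow> continuous_map mtopology mtopology (f n)"
    and surjective: "n \<ge> 1 \<Longrightarrow> f n ` X = X"
begin

primrec omega :: "nat \<Rightarrow> 'a \<Rightarrow> 'a" where
  "omega 0 = id"
| "omega (Suc k) = f (Suc k) \<circ> omega k"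

definition weakly_mixing :: bool where
  "weakly_mixing \<longleftrightarrow>
    (\<forall>U1 U2 V1 V2.
      openin mtopology U1 \<and> U1 \<noteq> {} \<and> openin mtopology U2 \<and> U2 \<noteq> {} \<and>
      openin mtopology V1 \<and> V1 \<noteq> {} \<and> openin mtopology V2 \<and> V2 \<noteq> {} \<longrightarrow>
      (\<exists>k\<ge>1. omega k ` U1 \<inter> V1 \<noteq> {} \<and> omega k ` U2 \<inter> V2 \<noteq> {}))"

text \<open>Neighbourhoods need not be open.\<close>

definition neighbourhood :: "'a \<Rightarrow> 'a set \<Rightarrow> bool" where
  "neighbourhood x U \<longleftrightarrow> U \<subseteq> X \<and> (\<exists>W. openin mtopology W \<and> x \<in> W \<and> W \<subseteq> U)"

definition regionally_proximal :: "'a \<Rightarrow> 'a \<Rightarrow> bool" where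
  "regionally_proximal x y \<longleftrightarrow>
    (\<forall>\<epsilon>>0. \<forall>U V. neighbourhood x U \<and> neighbourhood y V \<longrightarrow>
      (\<exists>z1\<in>U. \<exists>z2\<in>V. {n. n \<ge> 1 \<and> d (omega n z1) (omega n z2) < \<epsilon>} \<noteq> {}))"

definition Q :: "('a \<times> 'a) set" where
  "Q = {(x, y). x \<in> X \<and> y \<in> X \<and> regionally_proximal x y}"

end

end

theory Submission
  imports Defs
begin

text \<open>Weak mixing steers two open sets into two targets at one common time, and the targets
  may coincide. Regional proximality asks only that some point near \<open>x\<close> and some point
  near \<open>y\<close> be close at one common time, so a shared target of small diameter
  suffices.\<close>

text \<open>Weak mixing, applied with both targets equal to one small ball, moves points of any two
  non-empty open sets into that ball at the same time.\<close>

lemma (in nonautonomous_system) weakly_mixing_regionally_proximal: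
  assumes wm: weakly_mixing and "x \<in> X" "y \<in> X"
  shows "regionally_proximal x y"
  unfolding regionally_proximal_def
proof (intro allI impI, elim conjE)
  fix \<epsilon> :: real and U V
  assume \<epsilon>: "\<epsilon> > 0" and "neighbourhood x U" "neighbourhood y V"
  then obtain A B where A: "openin mtopology A" "x \<in> A" "A \<subseteq> U"
    and B: "openin mtopology B" "y \<in> B" "B \<subseteq> V"
    unfolding neighbourhood_def by blast
  \<comment> \<open>With radius \<epsilon>/2, any two points of the ball are less than \<epsilon>
    apart, by the triangle inequality through the centre. Any centre in \<open>X\<close> would do;
    \<open>x\<close> is at hand.\<close>
  let ?C = "mball x (\<epsilon>/2)"
  have "x \<in> ?C"
    using \<epsilon> \<open>x \<in> X\<close> by simp
  then have "openin mtopology ?C" "?C \<noteq> {}"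
    by (simp, blast)
  moreover have "A \<noteq> {}" "B \<noteq> {}"
    using A(2) B(2) by auto
  ultimately obtain k where k: "k \<ge> 1" "omega k ` A \<inter> ?C \<noteq> {}" "omega k ` B \<inter> ?C \<noteq> {}"
    using wm[unfolded weakly_mixing_def, rule_format, of A B ?C ?C] A(1) B(1) by metis
  then obtain z1 z2 where z: "z1 \<in> A" "z2 \<in> B" "omega k z1 \<in> ?C" "omega k z2 \<in> ?C"
    by blast
  then have "d (omega k z1) (omega k z2) < \<epsilon>"
    using triangle[of "omega k z1" x "omega k z2"] commute[of x "omega k z1"] by auto
  with k(1) z(1,2) A(3) B(3)
  show "\<exists>z1\<in>U. \<exists>z2\<in>V. {n. n \<ge> 1 \<and> d (omega n z1) (omega n z2) < \<epsilon>} \<noteq> {}"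
    by blast
qed

theorem proposition3p2:
  fixes X :: "'a set" and d :: "'a \<Rightarrow> 'a \<Rightarrow> real" and f :: "nat \<Rightarrow> 'a \<Rightarrow> 'a"
  assumes "nonautonomous_system X d f"
    and "nonautonomous_system.weakly_mixing X d f"
  shows "nonautonomous_system.Q X d f = X \<times> X"
proof -
  interpret nonautonomous_system X d f by fact
  show ?thesis
    \<comment> \<open>\<open>Q\<close> lies in \<open>X \<times> X\<close> by definition; the lemma
      gives the other inclusion.\<close>
    using weakly_mixing_regionally_proximal[OF assms(2)] by (auto simp: Q_def)
qed

end
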